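(* Let $Q$ be a probability distribution on $\mathbb{N}=\{1,2,\ldots\}$, let $n\ge 1$, and let $p_1,\dots,p_n\in(0,1)$. Let $S_n=\sum_{i=1}^n Y_i$ with $Y_i=B_iX_i$, where $X_1,\dots,X_n,B_1,\dots,B_n$ are mutually independent random variables, each $X_i$ has distribution $Q$, and each $B_i$ is Bernoulli with parameter $p_i$. Let $\lambda=\sum_{i=1}^n p_i$ and let $P_{S_n}$ be the distribution of $S_n$. Then $$D\big(P_{S_n}\,\big\|\,\mathrm{CPo}(\lambda,Q)\big)\;\le\;\frac1\lambda\sum_{i=1}^n\frac{p_i^3}{1-p_i}.$$
   Context: For $\lambda>0$ and a probability distribution $Q$ on $\mathbb{N}=\{1,2,\ldots\}$, the compound Poisson distribution $\mathrm{CPo}(\lambda,Q)$ is the distribution of $\sum_{i=1}^Z X_i$, where $Z$ is Poisson with parameter $\lambda$ and the $X_i$ are i.i.d. with distribution $Q$, independent of $Z$ (the empty sum is $0$). For probability distributions $P,P'$ on $\mathbb{Z}_+=\{0,1,2,\ldots\}$, the relative entropy is $D(P\|P')=\sum_{x\in\mathbb{Z}_+}P(x)\log\frac{P(x)}{P'(x)}$ (natural logarithm, with the usual conventions: terms with $P(x)=0$ are $0$, and $D(P\|P')=+\infty$ if $P(x)>0=P'(x)$ for some $x$). *)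

theory Defs
  imports "HOL-Probability.Probability"
begin

definition compound_poisson :: "real \<Rightarrow> nat pmf \<Rightarrow> nat pmf" where
  "compound_poisson lam Q =
     bind_pmf (poisson_pmf lam) (\<lambda>z. map_pmf sum_list (replicate_pmf z Q))"

definition rel_entropy_term :: "real \<Rightarrow> real \<Rightarrow> ereal" where
  "rel_entropy_term p q =
     (if p = 0 then 0 else if q = 0 then \<infinity> else ereal (p * ln (p / q)))"

(* The extended-real series of the terms is the sum of the positive parts minus the sum of
   the negative parts (e2ennreal sends negative arguments to 0).  For probability
   distributions the second sum is finite, because p * ln (q / p) \<le> q - p where q > p, so
   the difference is meaningful, and it is \<infinity> when the series diverges.  The library's
   KL_divergence is real-valued and cannot express the value \<infinity>. *)
definition rel_entropy :: "nat measure \<Rightarrow> nat measure \<Rightarrow> ereal" where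
  "rel_entropy P P' =
     enn2ereal (\<integral>\<^sup>+ x. e2ennreal (rel_entropy_term (measure P {x}) (measure P' {x}))
                  \<partial>count_space UNIV)
   - enn2ereal (\<integral>\<^sup>+ x. e2ennreal (- rel_entropy_term (measure P {x}) (measure P' {x}))
                  \<partial>count_space UNIV)"

end

theory Submission
  imports Defs "HOL-Real_Asymp.Real_Asymp"
begin

text \<open>Since $B_i \in \{0, 1\}$, the law of $S_n$ and $\mathrm{CPo}(\lambda, Q)$ are the images of the law
  $P$ of $W = B_1 + \cdots + B_n$ and of $\mathrm{Po}(\lambda)$ under one channel, which sends $w$ to the
  law of a sum of $w$ i.i.d. variables with law $Q$.  By data processing it suffices to bound
  $D(P \| \mathrm{Po}(\lambda))$.  The modified logarithmic Sobolev inequality for the Poisson law,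
  obtained from the binomial one by Poisson convergence, bounds it by the scaled Fisher information
  $\lambda \sum_k P(k) \big(\frac{(k+1) P(k+1)}{\lambda P(k)} - 1\big)^2$.  This quantity, multiplied by
  $\lambda$, grows by at most $p^3/(1-p)$ when an independent Bernoulli($p$) variable is added.\<close>

section \<open>Elementary two-point inequalities\<close>

lemma ln_ratio_le:
  fixes a m :: real
  assumes "0 \<le> a" "0 < m"
  shows "a * ln a \<le> a * ln m + a * (a - m) / m"
proof (cases "a = 0")
  case False
  with assms have "a * ln (a / m) \<le> a * (a / m - 1)"
    by (intro mult_left_mono ln_le_minus_one) auto
  with False assms show ?thesis by (simp add: ln_div field_simps)
qed simp

text \<open>The tangent bound \<open>ln x \<le> x - 1\<close> at \<open>a / m\<close> and
  \<open>b / m\<close> bounds the entropy by the variance \<open>p * (1 - p) * (b - a) ^ 2\<close>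
  divided by the mean \<open>m\<close>; then \<open>m \<ge> (1 - p) * a\<close> cancels the factor
  \<open>1 - p\<close>. If \<open>a = 0\<close>, also \<open>b = 0\<close>.\<close>

lemma two_point_entropy_le:
  fixes p a b d :: real
  assumes p: "0 < p" "p < 1" and "0 \<le> a" "0 \<le> b" "b - a = a * d"
  shows "(1 - p) * (a * ln a) + p * (b * ln b)
           - ((1 - p) * a + p * b) * ln ((1 - p) * a + p * b) \<le> p * (a * d\<^sup>2)"
proof (cases "a = 0")
  case False
  define m where "m = (1 - p) * a + p * b"
  have "0 < (1 - p) * a" using assms False by simp
  then have m: "(1 - p) * a \<le> m" "0 < m" using assms by (auto simp: m_def intro: add_pos_nonneg)
  have "(1 - p) * (a * ln a) + p * (b * ln b)
      \<le> (1 - p) * (a * ln m + a * (a - m) / m) + p * (b * ln m + b * (b - m) / m)"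
    using assms m by (intro add_mono mult_left_mono ln_ratio_le) auto
  also have "\<dots> = m * ln m + ((1 - p) * (a * (a - m)) + p * (b * (b - m))) / m"
    by (simp add: m_def algebra_simps add_divide_distrib diff_divide_distrib)
  also have "(1 - p) * (a * (a - m)) + p * (b * (b - m)) = p * (1 - p) * (b - a)\<^sup>2"
    unfolding m_def power2_eq_square by algebra
  also have "\<dots> / m \<le> p * (a * d\<^sup>2)"
  proof -
    have "p * (1 - p) * (b - a)\<^sup>2 = p * (a * d\<^sup>2) * ((1 - p) * a)"
      using assms by (simp add: power2_eq_square)
    also have "\<dots> \<le> p * (a * d\<^sup>2) * m"
      using assms m by (intro mult_left_mono) auto
    finally show ?thesis using m by (simp add: divide_le_eq)
  qed
  finally show ?thesis by (simp add: m_def)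
qed (use assms in simp)

text \<open>Convexity of the square for weights proportional to \<open>u\<close> and
  \<open>v\<close>. It serves both the conditional mean of increments and that of scores; for
  \<open>u + v = 0\<close> the quotient is 0 by convention.\<close>

lemma weighted_mean_square_le:
  fixes u v a b :: real
  assumes "0 \<le> u" "0 \<le> v"
  shows "(u + v) * ((u * a + v * b) / (u + v))\<^sup>2 \<le> u * a\<^sup>2 + v * b\<^sup>2"
proof (cases "u + v = 0")
  case False
  with assms have "0 < u + v" by simp
  have "(u * a + v * b)\<^sup>2 = (u * a\<^sup>2 + v * b\<^sup>2) * (u + v) - u * v * (a - b)\<^sup>2"
    unfolding power2_eq_square by algebra
  also have "\<dots> \<le> (u * a\<^sup>2 + v * b\<^sup>2) * (u + v)" using assms by simp
  finally have "(u * a + v * b)\<^sup>2 / (u + v) \<le> u * a\<^sup>2 + v * b\<^sup>2"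
    using \<open>0 < u + v\<close> by (simp add: divide_le_eq)
  then show ?thesis using False by (simp add: power2_eq_square)
qed (use assms in simp)

section \<open>Modified logarithmic Sobolev inequality for binomial laws\<close>

text \<open>Expectation under the binomial law, as a finite sum that is defined also for
  \<open>p > 1\<close>, which occurs for \<open>p = lam / n\<close> with small
  \<open>n\<close>.\<close>

definition binomial_mean :: "real \<Rightarrow> nat \<Rightarrow> (nat \<Rightarrow> real) \<Rightarrow> real" where
  "binomial_mean p n f = (\<Sum>k\<le>n. real (n choose k) * p ^ k * (1 - p) ^ (n - k) * f k)"

text \<open>Pascal's rule: conditioning on the outcome of one trial.\<close>

lemma binomial_mean_Suc:
  "binomial_mean p (Suc n) f = binomial_mean p n (\<lambda>k. (1 - p) * f k + p * f (Suc k))"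
proof -
  define b where "b n k = real (n choose k) * p ^ k * (1 - p) ^ (n - k)" for n k
  have 0: "b (Suc n) 0 = (1 - p) * b n 0" by (simp add: b_def)
  have S: "b (Suc n) (Suc k) = p * b n k + (1 - p) * b n (Suc k)" for k
  proof (cases "k < n")
    case True
    then have "n - k = Suc (n - Suc k)" by simp
    then show ?thesis by (simp add: b_def algebra_simps)
  qed (auto simp: b_def algebra_simps)
  have "(\<Sum>k\<le>Suc n. b (Suc n) k * f k)
      = (1 - p) * b n 0 * f 0 + (\<Sum>k\<le>n. (p * b n k + (1 - p) * b n (Suc k)) * f (Suc k))"
    by (simp only: sum.atMost_Suc_shift 0 S)
  also have "\<dots> = (\<Sum>k\<le>n. p * b n k * f (Suc k)) + (\<Sum>k\<le>Suc n. (1 - p) * b n k * f k)"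
    by (simp only: sum.atMost_Suc_shift distrib_right sum.distrib add_ac)
  also have "(\<Sum>k\<le>Suc n. (1 - p) * b n k * f k) = (\<Sum>k\<le>n. (1 - p) * b n k * f k)"
    by (simp add: b_def)
  also have "(\<Sum>k\<le>n. p * b n k * f (Suc k)) + (\<Sum>k\<le>n. (1 - p) * b n k * f k)
      = (\<Sum>k\<le>n. b n k * ((1 - p) * f k + p * f (Suc k)))"
    by (simp add: sum.distrib[symmetric] algebra_simps)
  finally show ?thesis unfolding binomial_mean_def b_def .
qed

lemma binomial_mean_mono:
  assumes "0 \<le> p" "p \<le> 1" "\<And>k. f k \<le> g k"
  shows "binomial_mean p n f \<le> binomial_mean p n g"
  unfolding binomial_mean_def using assms by (intro sum_mono mult_left_mono) auto

lemma binomial_mean_add: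
  "binomial_mean p n (\<lambda>k. f k + g k) = binomial_mean p n f + binomial_mean p n g"
  by (simp add: binomial_mean_def distrib_left sum.distrib)

lemma binomial_mean_cmult:
  "binomial_mean p n (\<lambda>k. c * f k) = c * binomial_mean p n f"
  by (simp add: binomial_mean_def sum_distrib_left mult_ac)

text \<open>Tensorization: conditioning on all but one trial splits the entropy into a two-point entropy
  and the entropy of the conditional mean, whose Dirichlet form is controlled by convexity of
  $(x, y) \mapsto y^2 / x$.  The relative increment \<open>d\<close> encodes the quotient
  $(f(k+1) - f(k))/f(k)$ and forces the support of \<open>f\<close> to be an initial segment.\<close>
lemma binomial_log_sobolev:
  assumes p: "0 < p" "p < 1"
    and "\<And>k. 0 \<le> f k" "\<And>k. f (Suc k) - f k = f k * d k"
  shows "binomial_mean p n (\<lambda>k. f k * ln (f k)) - binomial_mean p n f * ln (binomial_mean p n f)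
           \<le> real n * p / (1 - p) * binomial_mean p n (\<lambda>k. f k * (d k)\<^sup>2)"
  using assms(3,4)
proof (induction n arbitrary: f d)
  case 0
  then show ?case by (simp add: binomial_mean_def)
next
  case (Suc n)
  \<comment> \<open>\<open>g\<close> is the conditional mean of \<open>f\<close> given the other
    \<open>n\<close> trials, \<open>e\<close> its relative increment, \<open>\<Psi>\<close> the
    conditional mean of \<open>f * d ^ 2\<close>.\<close>
  define g where "g k = (1 - p) * f k + p * f (Suc k)" for k
  define e where "e k = ((1 - p) * f k * d k + p * f (Suc k) * d (Suc k)) / g k" for k
  define \<Psi> where "\<Psi> k = (1 - p) * (f k * (d k)\<^sup>2) + p * (f (Suc k) * (d (Suc k))\<^sup>2)" for k
  have g0: "0 \<le> g k" for k using Suc.prems p by (simp add: g_def)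
  have ge: "g (Suc k) - g k = g k * e k" for k
  proof -
    have "g (Suc k) - g k = (1 - p) * (f (Suc k) - f k) + p * (f (Suc (Suc k)) - f (Suc k))"
      by (simp add: g_def algebra_simps)
    also have "\<dots> = (1 - p) * f k * d k + p * f (Suc k) * d (Suc k)"
      by (simp add: Suc.prems)
    also have "\<dots> = g k * e k"
    proof (cases "g k = 0")
      case True
      then have "(1 - p) * f k = 0 \<and> p * f (Suc k) = 0"
        unfolding g_def using Suc.prems(1) p by (subst (asm) add_nonneg_eq_0_iff) auto
      then show ?thesis using True p by simp
    qed (simp add: e_def)
    finally show ?thesis .
  qed
  have e2: "g k * (e k)\<^sup>2 \<le> \<Psi> k" for k
    using weighted_mean_square_le[of "(1 - p) * f k" "p * f (Suc k)" "d k" "d (Suc k)"] Suc.prems p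
    by (simp add: g_def e_def \<Psi>_def mult.assoc)
  have tp: "(1 - p) * (f k * ln (f k)) + p * (f (Suc k) * ln (f (Suc k)))
      \<le> g k * ln (g k) + p / (1 - p) * \<Psi> k" for k
  proof -
    \<comment> \<open>The two-point bound involves only \<open>f k\<close>; it is compared with
      \<open>\<Psi> k\<close> by writing \<open>p = p / (1 - p) * (1 - p)\<close> and adding the
      nonnegative success term.\<close>
    have "p * (f k * (d k)\<^sup>2) = p / (1 - p) * ((1 - p) * (f k * (d k)\<^sup>2))" using p by simp
    also have "\<dots> \<le> p / (1 - p) * \<Psi> k"
      unfolding \<Psi>_def using p Suc.prems by (intro mult_left_mono) auto
    finally show ?thesis
      using two_point_entropy_le[OF p Suc.prems(1)[of k] Suc.prems(1)[of "Suc k"] Suc.prems(2)]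
      by (simp add: g_def)
  qed
  have "binomial_mean p (Suc n) (\<lambda>k. f k * ln (f k))
      \<le> binomial_mean p n (\<lambda>k. g k * ln (g k) + p / (1 - p) * \<Psi> k)"
    unfolding binomial_mean_Suc using p by (intro binomial_mean_mono tp) auto
  also have "\<dots> = binomial_mean p n (\<lambda>k. g k * ln (g k)) + p / (1 - p) * binomial_mean p n \<Psi>"
    by (simp add: binomial_mean_add binomial_mean_cmult del: times_divide_eq_left)
  \<comment> \<open>Induction supplies \<open>n\<close> copies of \<open>p / (1 - p)\<close>; the
    two-point entropy has supplied one more.\<close>
  also have "binomial_mean p n (\<lambda>k. g k * ln (g k))
      \<le> binomial_mean p n g * ln (binomial_mean p n g)
        + real n * p / (1 - p) * binomial_mean p n (\<lambda>k. g k * (e k)\<^sup>2)"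
    using Suc.IH[of g e] g0 ge by simp
  also have "real n * p / (1 - p) * binomial_mean p n (\<lambda>k. g k * (e k)\<^sup>2)
      \<le> real n * p / (1 - p) * binomial_mean p n \<Psi>"
    using p e2 by (intro mult_left_mono binomial_mean_mono) auto
  finally have "binomial_mean p (Suc n) (\<lambda>k. f k * ln (f k))
      \<le> binomial_mean p n g * ln (binomial_mean p n g) + real (Suc n) * p / (1 - p) * binomial_mean p n \<Psi>"
    by (simp add: algebra_simps add_divide_distrib)
  then show ?case
    by (simp add: binomial_mean_Suc g_def[abs_def] \<Psi>_def[abs_def])
qed

section \<open>Passage from binomial to Poisson laws\<close>

lemma binomial_div_power_tendsto:
  "(\<lambda>n. real (n choose k) / real n ^ k) \<longlonglongrightarrow> 1 / fact k"
proof (induction k)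
  case (Suc k)
  have "(\<lambda>n. real (n choose k) / real n ^ k * ((real n - real k) / real n) / real (Suc k))
      \<longlonglongrightarrow> 1 / fact k * 1 / real (Suc k)"
    by (intro tendsto_intros Suc.IH) (real_asymp, simp)
  moreover have "real (n choose k) / real n ^ k * ((real n - real k) / real n) / real (Suc k)
      = real (n choose Suc k) / real n ^ Suc k" for n
  proof -
    have "real (Suc k) * real (n choose Suc k) = (real n - real k) * real (n choose k)"
    proof (cases "k \<le> n")
      case True
      then show ?thesis
        using arg_cong[OF binomial_absorb_comp[of n k], of real]
              arg_cong[OF binomial_absorption[of k n], of real]
        by (metis Suc_times_binomial_add of_nat_diff of_nat_mult binomial_absorption choose_reduce_nat)
    qed (simp add: binomial_eq_0)
    then have "real (n choose Suc k) = (real n - real k) * real (n choose k) / real (Suc k)"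
      by (simp add: eq_divide_eq mult.commute del: of_nat_Suc)
    then show ?thesis by (simp add: mult_ac)
  qed
  ultimately show ?case by (simp add: mult_ac)
qed simp

text \<open>Factor \<open>(1 - lam / n) ^ (n - k)\<close> as an \<open>n\<close>-th power tending to
  \<open>exp (- lam)\<close> over a \<open>k\<close>-th power tending to 1.\<close>

lemma binomial_pmf_tendsto_poisson:
  fixes lam :: real
  shows "(\<lambda>n. real (n choose k) * (lam / n) ^ k * (1 - lam / n) ^ (n - k))
    \<longlonglongrightarrow> lam ^ k / fact k * exp (- lam)"
proof -
  have "(\<lambda>n. real (n choose k) / real n ^ k * lam ^ k * ((1 + (- lam) / n) ^ n / (1 - lam / n) ^ k))
      \<longlonglongrightarrow> 1 / fact k * lam ^ k * (exp (- lam) / (1 - 0) ^ k)"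
    by (intro tendsto_intros binomial_div_power_tendsto tendsto_exp_limit_sequentially
          tendsto_divide_0[OF tendsto_const] filterlim_at_top_imp_at_infinity filterlim_real_sequentially) auto
  then have "(\<lambda>n. real (n choose k) / real n ^ k * lam ^ k * ((1 - lam / n) ^ n / (1 - lam / n) ^ k))
      \<longlonglongrightarrow> lam ^ k / fact k * exp (- lam)"
    by simp
  moreover have "\<forall>\<^sub>F n in sequentially.
      real (n choose k) / real n ^ k * lam ^ k * ((1 - lam / n) ^ n / (1 - lam / n) ^ k)
      = real (n choose k) * (lam / n) ^ k * (1 - lam / n) ^ (n - k)"
    \<comment> \<open>For \<open>n > \<bar>lam\<bar>\<close> the base is nonzero, and
      \<open>n \<ge> k\<close> lets the power be split.\<close>
    using eventually_gt_at_top[of "nat \<lceil>\<bar>lam\<bar>\<rceil>"] eventually_ge_at_top[of k]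
  proof eventually_elim
    case (elim n)
    then have "1 - lam / n \<noteq> 0" by (auto simp: field_simps)
    with elim show ?case by (simp add: power_diff power_divide)
  qed
  ultimately show ?thesis by (rule Lim_transform_eventually)
qed

text \<open>Finite support of \<open>f\<close> reduces convergence of expectations to convergence of
  finitely many masses.\<close>

lemma binomial_mean_tendsto_poisson:
  fixes lam :: real
  assumes "\<And>k. k > m \<Longrightarrow> f k = 0"
  shows "(\<lambda>n. binomial_mean (lam / n) n f) \<longlonglongrightarrow> (\<Sum>k\<le>m. lam ^ k / fact k * exp (- lam) * f k)"
proof -
  have "(\<lambda>n. \<Sum>k\<le>m. real (n choose k) * (lam / n) ^ k * (1 - lam / n) ^ (n - k) * f k)
      \<longlonglongrightarrow> (\<Sum>k\<le>m. lam ^ k / fact k * exp (- lam) * f k)"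
    by (intro tendsto_intros binomial_pmf_tendsto_poisson)
  moreover have "\<forall>\<^sub>F n in sequentially.
      (\<Sum>k\<le>m. real (n choose k) * (lam / n) ^ k * (1 - lam / n) ^ (n - k) * f k)
      = binomial_mean (lam / n) n f"
    using eventually_ge_at_top[of m]
    by eventually_elim
      (unfold binomial_mean_def, intro sum.mono_neutral_left, auto simp: assms)
  ultimately show ?thesis by (rule Lim_transform_eventually)
qed

text \<open>Limit of the binomial inequality with \<open>p = lam / n\<close>, whose constant
  \<open>lam / (1 - lam / n)\<close> tends to \<open>lam\<close>. \<open>E f = 1\<close> removes the
  term \<open>E f * ln (E f)\<close> and keeps the limit away from the singularity of
  \<open>ln\<close>.\<close>

lemma poisson_log_sobolev:
  fixes lam :: real
  assumes "0 < lam" "\<And>k. 0 \<le> f k" "\<And>k. f (Suc k) - f k = f k * d k" "\<And>k. k > m \<Longrightarrow> f k = 0"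
  defines "E \<equiv> \<lambda>h. \<Sum>k\<le>m. lam ^ k / fact k * exp (- lam) * h k"
  assumes E1: "E f = 1"
  shows "E (\<lambda>k. f k * ln (f k)) \<le> lam * E (\<lambda>k. f k * (d k)\<^sup>2)"
proof -
  have lim: "(\<lambda>n. binomial_mean (lam / n) n h) \<longlonglongrightarrow> E h" if "\<And>k. k > m \<Longrightarrow> h k = 0" for h
    unfolding E_def using that by (rule binomial_mean_tendsto_poisson)
  have entropy: "(\<lambda>n. binomial_mean (lam / n) n (\<lambda>k. f k * ln (f k))
          - binomial_mean (lam / n) n f * ln (binomial_mean (lam / n) n f))
        \<longlonglongrightarrow> E (\<lambda>k. f k * ln (f k)) - E f * ln (E f)"
    by (intro tendsto_intros lim) (use E1 in \<open>auto simp: assms(4)\<close>)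
  have energy: "(\<lambda>n. lam / (1 - lam / n) * binomial_mean (lam / n) n (\<lambda>k. f k * (d k)\<^sup>2))
        \<longlonglongrightarrow> lam / (1 - 0) * E (\<lambda>k. f k * (d k)\<^sup>2)"
    by (intro tendsto_intros lim tendsto_divide_0[OF tendsto_const]
         filterlim_at_top_imp_at_infinity filterlim_real_sequentially) (auto simp: assms)
  have "\<forall>\<^sub>F n in sequentially. binomial_mean (lam / n) n (\<lambda>k. f k * ln (f k))
          - binomial_mean (lam / n) n f * ln (binomial_mean (lam / n) n f)
        \<le> lam / (1 - lam / n) * binomial_mean (lam / n) n (\<lambda>k. f k * (d k)\<^sup>2)"
    \<comment> \<open>For these \<open>n\<close>, \<open>lam / n\<close> lies strictly between 0 and
      1.\<close>
    using eventually_gt_at_top[of "nat \<lceil>lam\<rceil>"]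
  proof eventually_elim
    case (elim n)
    then have n: "lam < n" "0 < n" using assms(1) by linarith+
    then show ?case
      using binomial_log_sobolev[of "lam / n" f d n] assms by simp
  qed
  then have "E (\<lambda>k. f k * ln (f k)) - E f * ln (E f) \<le> lam / (1 - 0) * E (\<lambda>k. f k * (d k)\<^sup>2)"
    by (rule tendsto_le[OF trivial_limit_sequentially energy entropy])
  then show ?thesis by (simp add: E1)
qed

section \<open>Scaled Fisher information and its growth\<close>

text \<open>Here and below \<open>r\<close> is $\lambda$ times the score $(k+1) P(k+1)/(\lambda P(k)) - 1$, in the division-free
  form that remains meaningful where $P$ vanishes.\<close>
lemma poisson_relative_entropy_le_fisher:
  fixes lam :: real
  assumes "0 < lam" "\<And>k. 0 \<le> P k" "\<And>k. k > m \<Longrightarrow> P k = 0" "(\<Sum>k\<le>m. P k) = 1"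
    and r: "\<And>k. real (Suc k) * P (Suc k) - lam * P k = P k * r k"
  shows "(\<Sum>k\<le>m. P k * ln (P k / (lam ^ k / fact k * exp (- lam))))
           \<le> 1 / lam * (\<Sum>k\<le>m. P k * (r k)\<^sup>2)"
proof -
  define po where "po k = lam ^ k / fact k * exp (- lam)" for k
  have po: "0 < po k" for k using assms(1) by (simp add: po_def)
  have poS: "po (Suc k) = po k * lam / real (Suc k)" for k by (simp add: po_def mult_ac)
  \<comment> \<open>\<open>f\<close> is the density of \<open>P\<close> with respect to the Poisson
    law. Since \<open>po (k + 1) / po k = lam / (k + 1)\<close>, its relative increment is the score
    \<open>r k / lam\<close>.\<close>
  define f where "f k = P k / po k" for k
  have pof: "po k * f k = P k" for k using po[of k] by (simp add: f_def)
  have "(\<Sum>k\<le>m. po k * (f k * ln (f k))) \<le> lam * (\<Sum>k\<le>m. po k * (f k * (r k / lam)\<^sup>2))"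
    unfolding po_def
  proof (rule poisson_log_sobolev)
    fix k
    have "f (Suc k) = real (Suc k) * P (Suc k) / (lam * po k)"
      by (simp add: f_def poS mult.commute del: of_nat_Suc)
    also have "\<dots> = (P k * r k + lam * P k) / (lam * po k)"
      by (simp only: diff_eq_eq[THEN iffD1, OF r])
    also have "\<dots> = f k + f k * (r k / lam)"
      using assms(1) by (simp add: f_def add_divide_distrib mult.commute)
    finally show "f (Suc k) - f k = f k * (r k / lam)" by simp
    show "0 \<le> f k" using assms po[of k] by (simp add: f_def)
  next
    show "(\<Sum>k\<le>m. lam ^ k / fact k * exp (- lam) * f k) = 1"
      using assms(4) by (simp only: po_def[symmetric] pof)
  qed (use assms in \<open>auto simp: f_def\<close>)
  also have "lam * (\<Sum>k\<le>m. po k * (f k * (r k / lam)\<^sup>2)) = 1 / lam * (\<Sum>k\<le>m. P k * (r k)\<^sup>2)"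
    using assms(1)
    by (simp only: mult.assoc[symmetric] pof) (simp add: power_divide sum_divide_distrib[symmetric] power2_eq_square)
  finally show ?thesis
    by (simp only: mult.assoc[symmetric] pof) (simp only: f_def po_def)
qed

text \<open>Conditionally on the new sum, \<open>r'\<close> is a weighted mean of \<open>r\<close> shifted by
  $p^2/q$ (new variable 0) and by $-p$ (new variable 1).  These shifts have mean zero, so the cross
  terms cancel.\<close>
lemma fisher_information_add_bernoulli:
  fixes P P' r :: "nat \<Rightarrow> real" and lam p :: real
  assumes p: "0 < p" "p < 1"
    and P: "\<And>k. 0 \<le> P k" "\<And>k. k > m \<Longrightarrow> P k = 0" "(\<Sum>k\<le>m. P k) = 1"
    and r: "\<And>k. real (Suc k) * P (Suc k) - lam * P k = P k * r k"
    and P': "P' 0 = (1 - p) * P 0" "\<And>k. P' (Suc k) = (1 - p) * P (Suc k) + p * P k"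
  shows "\<exists>r'. (\<forall>k. real (Suc k) * P' (Suc k) - (lam + p) * P' k = P' k * r' k)
           \<and> (\<Sum>k\<le>Suc m. P' k * (r' k)\<^sup>2) \<le> (\<Sum>k\<le>m. P k * (r k)\<^sup>2) + p ^ 3 / (1 - p)"
proof -
  define q where "q = 1 - p"
  have q: "0 < q" "p = 1 - q" using p by (auto simp: q_def)
  \<comment> \<open>\<open>u k\<close> and \<open>v k\<close> are the masses of the new sum at
    \<open>k\<close> with new variable 0 and 1. As \<open>v 0 = 0\<close>, the value
    \<open>b 0\<close> with its truncated index \<open>0 - 1\<close> gets weight 0.\<close>
  define u where "u k = q * P k" for k
  define v where "v k = (case k of 0 \<Rightarrow> 0 | Suc j \<Rightarrow> p * P j)" for k
  define a where "a k = r k + p\<^sup>2 / q" for k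
  define b where "b k = r (k - 1) - p" for k
  define r' where "r' k = (u k * a k + v k * b k) / (u k + v k)" for k
  have uv: "0 \<le> u k" "0 \<le> v k" for k
    using P(1) p q by (auto simp: u_def v_def split: nat.split)
  have P'uv: "P' k = u k + v k" for k
    using P' by (cases k) (auto simp: u_def v_def q_def)
  \<comment> \<open>Beyond the old scores weighted by \<open>q\<close> and \<open>p\<close>, what
    remains is \<open>p ^ 2 * P k - p ^ 2 * P (k - 1)\<close>, without the second term if
    \<open>k = 0\<close>; dividing by the weights \<open>q\<close> and \<open>p\<close> gives the
    shifts \<open>p ^ 2 / q\<close> and \<open>- p\<close>.\<close>
  have score: "real (Suc k) * P' (Suc k) - (lam + p) * P' k = u k * a k + v k * b k" for k
  proof -
    have ua: "u k * a k = q * (real (Suc k) * P (Suc k) - lam * P k) + p\<^sup>2 * P k"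
    proof -
      have "u k * a k = q * (P k * r k) + p\<^sup>2 * P k"
        using q(1) by (simp add: u_def a_def distrib_left)
      then show ?thesis by (simp only: r)
    qed
    show ?thesis
    proof (cases k)
      case 0
      then show ?thesis
        unfolding ua P' q_def by (simp add: v_def algebra_simps power2_eq_square P')
    next
      case (Suc j)
      have vb: "v k * b k = p * (real k * P k - lam * P j) - p\<^sup>2 * P j"
      proof -
        have "v k * b k = p * (P j * r j) - p\<^sup>2 * P j"
          by (simp add: v_def b_def Suc algebra_simps power2_eq_square)
        then show ?thesis by (simp only: r Suc)
      qed
      have "P' k = (1 - p) * P k + p * P j" by (simp add: Suc P')
      then show ?thesis
        by (simp only: ua vb P' q_def) (simp add: Suc algebra_simps power2_eq_square)
    qed
  qed
  have "u k * a k + v k * b k = P' k * r' k" for k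
    using add_nonneg_eq_0_iff[OF uv(1)[of k] uv(2)[of k]] by (cases "u k + v k = 0") (simp_all add: P'uv r'_def)
  with score have 1: "\<forall>k. real (Suc k) * P' (Suc k) - (lam + p) * P' k = P' k * r' k" by simp
  have "(\<Sum>k\<le>Suc m. P' k * (r' k)\<^sup>2) \<le> (\<Sum>k\<le>Suc m. u k * (a k)\<^sup>2 + v k * (b k)\<^sup>2)"
    unfolding P'uv r'_def by (intro sum_mono weighted_mean_square_le uv)
  \<comment> \<open>\<open>P (Suc m) = 0\<close> shortens the first sum; the second is reindexed
    next, as \<open>v\<close> is a shift of \<open>P\<close>.\<close>
  also have "\<dots> = (\<Sum>k\<le>m. u k * (a k)\<^sup>2) + (\<Sum>k\<le>Suc m. v k * (b k)\<^sup>2)"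
    using P(2)[of "Suc m"] by (simp add: sum.distrib u_def)
  also have "(\<Sum>k\<le>Suc m. v k * (b k)\<^sup>2) = (\<Sum>k\<le>m. p * P k * (r k - p)\<^sup>2)"
    by (simp only: sum.atMost_Suc_shift) (simp add: v_def b_def)
  also have "(\<Sum>k\<le>m. u k * (a k)\<^sup>2) + (\<Sum>k\<le>m. p * P k * (r k - p)\<^sup>2)
      = (\<Sum>k\<le>m. P k * (r k)\<^sup>2 + p ^ 3 / q * P k)"
  proof -
    \<comment> \<open>The terms linear in \<open>x\<close> cancel; the constants are
      \<open>p ^ 4 / q + p ^ 3 = p ^ 3 / q\<close>, as \<open>p + q = 1\<close>.\<close>
    have square: "q * (x + p\<^sup>2 / q)\<^sup>2 + p * (x - p)\<^sup>2 = x\<^sup>2 + p ^ 3 / q" for x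
    proof -
      have "q * (q * (x + p\<^sup>2 / q)\<^sup>2 + p * (x - p)\<^sup>2) = (q * x + p\<^sup>2)\<^sup>2 + q * p * (x - p)\<^sup>2"
        using q(1) by (simp add: power2_eq_square field_simps)
      also have "\<dots> = q * (x\<^sup>2 + p ^ 3 / q)"
        using q(1) by (simp add: distrib_left) (simp add: q(2) power2_eq_square power3_eq_cube algebra_simps)
      finally show ?thesis using q(1) by simp
    qed
    have "u k * (a k)\<^sup>2 + p * P k * (r k - p)\<^sup>2 = P k * (r k)\<^sup>2 + p ^ 3 / q * P k" for k
    proof -
      have "u k * (a k)\<^sup>2 + p * P k * (r k - p)\<^sup>2
          = P k * (q * (r k + p\<^sup>2 / q)\<^sup>2 + p * (r k - p)\<^sup>2)"
        by (simp only: u_def a_def distrib_left mult_ac)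
      then show ?thesis by (simp only: square distrib_left mult.commute)
    qed
    then show ?thesis by (simp only: sum.distrib[symmetric])
  qed
  also have "\<dots> = (\<Sum>k\<le>m. P k * (r k)\<^sup>2) + p ^ 3 / q"
    by (simp only: sum.distrib sum_distrib_left[symmetric] P(3) mult_1_right)
  finally show ?thesis using 1 unfolding q_def by blast
qed

section \<open>Laws of Bernoulli sums\<close>

definition plus_pmf :: "nat pmf \<Rightarrow> nat pmf \<Rightarrow> nat pmf" where
  "plus_pmf P R = map_pmf (\<lambda>(a, b). a + b) (pair_pmf P R)"

lemma plus_pmf_eq_bind: "plus_pmf P R = bind_pmf P (\<lambda>a. bind_pmf R (\<lambda>b. return_pmf (a + b)))"
  by (simp add: plus_pmf_def pair_pmf_def map_bind_pmf)

lemma plus_pmf_eq_bind': "plus_pmf P R = bind_pmf R (\<lambda>b. map_pmf (\<lambda>a. a + b) P)"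
  unfolding plus_pmf_eq_bind map_pmf_def by (rule bind_commute_pmf)

lemma pmf_plus_bernoulli:
  fixes p :: real and P :: "nat pmf"
  assumes "0 \<le> p" "p \<le> 1"
  defines "R \<equiv> plus_pmf P (map_pmf of_bool (bernoulli_pmf p))"
  shows "pmf R 0 = (1 - p) * pmf P 0"
    and "pmf R (Suc k) = (1 - p) * pmf P (Suc k) + p * pmf P k"
proof -
  have "R = bind_pmf (bernoulli_pmf p) (\<lambda>b. map_pmf (\<lambda>a. a + of_bool b) P)"
    unfolding R_def plus_pmf_eq_bind' by (simp only: bind_map_pmf comp_def)
  then have R: "pmf R j = p * pmf (map_pmf Suc P) j + (1 - p) * pmf P j" for j
    using assms(1,2) by (simp add: pmf_bind integral_bernoulli_pmf)
  have "pmf (map_pmf Suc P) 0 = 0" by (auto simp: pmf_eq_0_set_pmf)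
  then show "pmf R 0 = (1 - p) * pmf P 0" unfolding R by simp
  show "pmf R (Suc k) = (1 - p) * pmf P (Suc k) + p * pmf P k"
    unfolding R by (subst pmf_map_inj') simp_all
qed

text \<open>The summands are numbered from 1, so stage \<open>m\<close> involves \<open>p 1\<close>
  to \<open>p m\<close>.\<close>

primrec bernoulli_sum_pmf :: "(nat \<Rightarrow> real) \<Rightarrow> nat \<Rightarrow> nat pmf" where
  "bernoulli_sum_pmf p 0 = return_pmf 0"
| "bernoulli_sum_pmf p (Suc m) =
     plus_pmf (bernoulli_sum_pmf p m) (map_pmf of_bool (bernoulli_pmf (p (Suc m))))"

lemma set_bernoulli_sum_pmf: "set_pmf (bernoulli_sum_pmf p m) \<subseteq> {..m}"
proof (induction m)
  case (Suc m)
  then show ?case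
    by (fastforce simp: plus_pmf_def)
qed simp

lemma pmf_bernoulli_sum_eq_0: "m < k \<Longrightarrow> pmf (bernoulli_sum_pmf p m) k = 0"
  using set_bernoulli_sum_pmf[of p m] by (auto simp: pmf_eq_0_set_pmf)

lemma sum_pmf_bernoulli_sum: "(\<Sum>k\<le>m. pmf (bernoulli_sum_pmf p m) k) = 1"
  by (intro sum_pmf_eq_1 set_bernoulli_sum_pmf) simp

text \<open>Start from the point mass at 0, whose mean 0 allows \<open>r = 0\<close>, and add one
  variable at a time; each contributes its own summand of the bound.\<close>

lemma fisher_information_bernoulli_sum:
  assumes "\<And>i. i \<in> {1..m} \<Longrightarrow> p i \<in> {0<..<1}"
  defines "P \<equiv> pmf (bernoulli_sum_pmf p m)"
  shows "\<exists>r. (\<forall>k. real (Suc k) * P (Suc k) - (\<Sum>i=1..m. p i) * P k = P k * r k)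
           \<and> (\<Sum>k\<le>m. P k * (r k)\<^sup>2) \<le> (\<Sum>i=1..m. p i ^ 3 / (1 - p i))"
  using assms(1) unfolding P_def
proof (induction m)
  case 0
  show ?case by (intro exI[of _ "\<lambda>_. 0"]) (simp add: pmf_return)
next
  case (Suc m)
  then obtain r where
    r: "\<And>k. real (Suc k) * pmf (bernoulli_sum_pmf p m) (Suc k)
          - (\<Sum>i=1..m. p i) * pmf (bernoulli_sum_pmf p m) k = pmf (bernoulli_sum_pmf p m) k * r k"
    and r2: "(\<Sum>k\<le>m. pmf (bernoulli_sum_pmf p m) k * (r k)\<^sup>2) \<le> (\<Sum>i=1..m. p i ^ 3 / (1 - p i))"
    by fastforce
  have p: "0 < p (Suc m)" "p (Suc m) < 1" using Suc.prems[of "Suc m"] by auto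
  let ?P = "pmf (bernoulli_sum_pmf p (Suc m))"
  obtain r' where
    "\<forall>k. real (Suc k) * ?P (Suc k) - ((\<Sum>i=1..m. p i) + p (Suc m)) * ?P k = ?P k * r' k"
    "(\<Sum>k\<le>Suc m. ?P k * (r' k)\<^sup>2)
       \<le> (\<Sum>k\<le>m. pmf (bernoulli_sum_pmf p m) k * (r k)\<^sup>2) + p (Suc m) ^ 3 / (1 - p (Suc m))"
    using fisher_information_add_bernoulli[where P' = ?P, OF p pmf_nonneg pmf_bernoulli_sum_eq_0
        sum_pmf_bernoulli_sum r] p
    by (auto simp: pmf_plus_bernoulli)
  with r2 show ?case
    by (intro exI[of _ r']) auto
qed

lemma bernoulli_sum_poisson_entropy_le:
  assumes "n \<ge> 1" "\<And>i. i \<in> {1..n} \<Longrightarrow> p i \<in> {0<..<1}"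
  defines "lam \<equiv> \<Sum>i=1..n. p i" and "P \<equiv> bernoulli_sum_pmf p n"
  shows "(\<Sum>k\<in>set_pmf P. pmf P k * ln (pmf P k / pmf (poisson_pmf lam) k))
           \<le> 1 / lam * (\<Sum>i=1..n. p i ^ 3 / (1 - p i))"
proof -
  have lam: "0 < lam" unfolding lam_def using assms by (intro sum_pos) auto
  obtain r where
    r: "\<And>k. real (Suc k) * pmf P (Suc k) - lam * pmf P k = pmf P k * r k"
       "(\<Sum>k\<le>n. pmf P k * (r k)\<^sup>2) \<le> (\<Sum>i=1..n. p i ^ 3 / (1 - p i))"
    using fisher_information_bernoulli_sum[of n p, OF assms(2)] unfolding lam_def P_def by blast
  have "(\<Sum>k\<in>set_pmf P. pmf P k * ln (pmf P k / pmf (poisson_pmf lam) k))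
      = (\<Sum>k\<le>n. pmf P k * ln (pmf P k / (lam ^ k / fact k * exp (- lam))))"
    using lam set_bernoulli_sum_pmf[of p n]
    by (intro sum.mono_neutral_cong_left) (auto simp: P_def set_pmf_iff)
  also have "\<dots> \<le> 1 / lam * (\<Sum>k\<le>n. pmf P k * (r k)\<^sup>2)"
    using lam r(1) by (intro poisson_relative_entropy_le_fisher)
      (auto simp: P_def pmf_bernoulli_sum_eq_0 sum_pmf_bernoulli_sum)
  also have "\<dots> \<le> 1 / lam * (\<Sum>i=1..n. p i ^ 3 / (1 - p i))"
    using r(2) lam by (intro mult_left_mono) auto
  finally show ?thesis .
qed

section \<open>Relative entropy and data processing\<close>

text \<open>The tangent bound makes each term at least \<open>- pmf R s\<close>, and
  \<open>u\<close> bounds it above, so the series converges absolutely and the difference of the two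
  extended integrals is an ordinary integral.\<close>

lemma rel_entropy_le_integral:
  fixes P R :: "nat pmf"
  assumes ac: "set_pmf P \<subseteq> set_pmf R"
    and u: "integrable (count_space UNIV) u"
    and le: "\<And>s. pmf P s * ln (pmf P s / pmf R s) \<le> u s"
  shows "rel_entropy (measure_pmf P) (measure_pmf R) \<le> ereal (\<integral>s. u s \<partial>count_space UNIV)"
proof -
  define t where "t s = pmf P s * ln (pmf P s / pmf R s)" for s
  have tR: "- pmf R s \<le> t s" for s
  proof (cases "pmf P s = 0")
    case False
    then have pos: "0 < pmf P s" "0 < pmf R s"
      using ac by (auto simp: pmf_positive set_pmf_iff)
    then have "pmf P s * ln (pmf R s / pmf P s) \<le> pmf P s * (pmf R s / pmf P s - 1)"
      by (intro mult_left_mono ln_le_minus_one) auto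
    with pos show ?thesis by (simp add: t_def ln_div algebra_simps)
  qed (simp add: t_def)
  have t: "integrable (count_space UNIV) t"
  proof (rule Bochner_Integration.integrable_bound)
    show "integrable (count_space UNIV) (\<lambda>s. \<bar>u s\<bar> + pmf R s)"
      by (intro Bochner_Integration.integrable_add integrable_abs u integrable_pmf)
    show "AE s in count_space UNIV. norm (t s) \<le> norm (\<bar>u s\<bar> + pmf R s)"
      using le tR by (intro AE_I2) (smt (verit) pmf_nonneg real_norm_def t_def)
  qed simp
  \<comment> \<open>Absolute continuity excludes the value \<open>\<infinity>\<close>.\<close>
  have term_eq: "rel_entropy_term (pmf P s) (pmf R s) = ereal (t s)" for s
    using ac by (auto simp: rel_entropy_term_def t_def set_pmf_iff)
  have fin: "(\<integral>\<^sup>+s. ennreal (f s) \<partial>count_space UNIV) < \<infinity>"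
    if "integrable (count_space UNIV) f" for f :: "nat \<Rightarrow> real"
  proof -
    have "(\<integral>\<^sup>+s. ennreal (f s) \<partial>count_space UNIV) \<le> (\<integral>\<^sup>+s. ennreal (norm (f s)) \<partial>count_space UNIV)"
      by (intro nn_integral_mono ennreal_leI) auto
    then show ?thesis using that by (auto simp: integrable_iff_bounded)
  qed
  have enn2ereal_finite: "enn2ereal x = ereal (enn2real x)" if "x < \<infinity>" for x
    using that by (metis enn2ereal_ennreal enn2real_nonneg ennreal_enn2real infinity_ennreal_def)
  have "rel_entropy (measure_pmf P) (measure_pmf R)
      = enn2ereal (\<integral>\<^sup>+s. ennreal (t s) \<partial>count_space UNIV)
        - enn2ereal (\<integral>\<^sup>+s. ennreal (- t s) \<partial>count_space UNIV)"
    by (simp add: rel_entropy_def measure_pmf_single term_eq e2ennreal_ereal)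
  also have "\<dots> = ereal (\<integral>s. t s \<partial>count_space UNIV)"
    unfolding enn2ereal_finite[OF fin[OF t]]
      enn2ereal_finite[OF fin[OF Bochner_Integration.integrable_minus[OF t]]]
      real_lebesgue_integral_def[OF t] by simp
  also have "\<dots> \<le> ereal (\<integral>s. u s \<partial>count_space UNIV)"
    unfolding ereal_less_eq by (intro integral_mono t u) (simp add: t_def le)
  finally show ?thesis .
qed

text \<open>The log-sum inequality, applied pointwise in the output \<open>s\<close> of the channel \<open>K\<close>.\<close>
lemma rel_entropy_bind_pmf_le:
  fixes K :: "'b \<Rightarrow> nat pmf"
  assumes fin: "finite (set_pmf W)" and ac: "set_pmf W \<subseteq> set_pmf V"
  shows "rel_entropy (measure_pmf (bind_pmf W K)) (measure_pmf (bind_pmf V K))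
           \<le> ereal (\<Sum>w\<in>set_pmf W. pmf W w * ln (pmf W w / pmf V w))"
proof -
  define c where "c w = pmf W w * ln (pmf W w / pmf V w)" for w
  \<comment> \<open>Each \<open>c w\<close> is spread over the outputs according to
    \<open>K w\<close>, so \<open>u\<close> sums to the claimed bound.\<close>
  define u where "u s = (\<Sum>w\<in>set_pmf W. c w * pmf (K w) s)" for s
  let ?A = "pmf (bind_pmf W K)" and ?B = "pmf (bind_pmf V K)"
  have A: "?A s = (\<Sum>w\<in>set_pmf W. pmf W w * pmf (K w) s)" for s
    unfolding pmf_bind using fin by (subst integral_measure_pmf_real) (auto simp: mult.commute)
  \<comment> \<open>Only an inequality, as \<open>V\<close> may charge points outside the support of
    \<open>W\<close>.\<close>
  have B: "(\<Sum>w\<in>set_pmf W. pmf V w * pmf (K w) s) \<le> ?B s" for s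
  proof -
    have int: "integrable (measure_pmf V) (\<lambda>w. pmf (K w) s * indicator (set_pmf W) w)"
      "integrable (measure_pmf V) (\<lambda>w. pmf (K w) s)"
      by (auto intro!: measure_pmf.integrable_const_bound[where B=1] simp: pmf_le_1 indicator_def)
    have "(\<Sum>w\<in>set_pmf W. pmf V w * pmf (K w) s)
        = (\<integral>w. pmf (K w) s * indicator (set_pmf W) w \<partial>measure_pmf V)"
      using fin by (subst integral_measure_pmf_real[of "set_pmf W"])
        (auto simp: mult.commute indicator_def intro!: sum.cong)
    also have "\<dots> \<le> ?B s"
      unfolding pmf_bind using int by (intro integral_mono) (auto simp: indicator_def)
    finally show ?thesis .
  qed
  have ac': "set_pmf (bind_pmf W K) \<subseteq> set_pmf (bind_pmf V K)" using ac by auto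
  have "?A s * ln (?A s / ?B s) \<le> u s" for s
  proof (cases "?A s = 0")
    case True
    have "pmf W w * pmf (K w) s = 0" if "w \<in> set_pmf W" for w
      using True fin that unfolding A by (subst (asm) sum_nonneg_eq_0_iff) auto
    then have "u s = 0" unfolding u_def c_def
      by (intro sum.neutral) (auto simp: set_pmf_iff)
    with True show ?thesis by simp
  next
    case False
    then have pos: "0 < ?A s" "0 < ?B s"
      using ac' by (auto simp: pmf_positive set_pmf_iff simp del: set_bind_pmf)
    \<comment> \<open>The tangent bound at the quotient of \<open>?A s / ?B s\<close> by
      \<open>pmf W w / pmf V w\<close> linearizes each summand. Summed over \<open>w\<close>, the
      linear terms are nonnegative by \<open>B\<close>.\<close>
    have "pmf W w * pmf (K w) s * ln (?A s / ?B s) + pmf W w * pmf (K w) s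
        - ?A s / ?B s * (pmf V w * pmf (K w) s) \<le> c w * pmf (K w) s" if w: "w \<in> set_pmf W" for w
    proof -
      have wp: "0 < pmf W w" "0 < pmf V w" using w ac by (auto simp: pmf_positive)
      define x where "x = (?A s * pmf V w) / (?B s * pmf W w)"
      have "0 < x" using pos wp by (simp add: x_def)
      have "ln x = ln (?A s / ?B s) - ln (pmf W w / pmf V w)"
        unfolding x_def using pos wp by (simp add: ln_div ln_mult)
      then have "pmf W w * pmf (K w) s * (ln (?A s / ?B s) - ln (pmf W w / pmf V w))
          \<le> pmf W w * pmf (K w) s * (x - 1)"
        using ln_le_minus_one[OF \<open>0 < x\<close>] by (intro mult_left_mono) auto
      also have "\<dots> = ?A s / ?B s * (pmf V w * pmf (K w) s) - pmf W w * pmf (K w) s"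
        using wp pos by (simp add: x_def field_simps)
      finally show ?thesis by (simp add: c_def algebra_simps)
    qed
    then have "(\<Sum>w\<in>set_pmf W. pmf W w * pmf (K w) s * ln (?A s / ?B s) + pmf W w * pmf (K w) s
        - ?A s / ?B s * (pmf V w * pmf (K w) s)) \<le> u s"
      unfolding u_def by (rule sum_mono)
    then have "?A s * ln (?A s / ?B s) + ?A s
        - ?A s / ?B s * (\<Sum>w\<in>set_pmf W. pmf V w * pmf (K w) s) \<le> u s"
      by (simp only: A sum.distrib sum_subtractf sum_distrib_left sum_distrib_right)
    moreover have "?A s / ?B s * (\<Sum>w\<in>set_pmf W. pmf V w * pmf (K w) s) \<le> ?A s / ?B s * ?B s"
      using pos by (intro mult_left_mono B) auto
    ultimately show ?thesis using pos by simp
  qed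
  moreover have "integrable (count_space UNIV) u"
    unfolding u_def by (intro Bochner_Integration.integrable_sum integrable_mult_right integrable_pmf)
  ultimately have "rel_entropy (measure_pmf (bind_pmf W K)) (measure_pmf (bind_pmf V K))
      \<le> ereal (\<integral>s. u s \<partial>count_space UNIV)"
    using ac' by (intro rel_entropy_le_integral)
  also have "(\<integral>s. u s \<partial>count_space UNIV) = (\<Sum>w\<in>set_pmf W. c w)"
    unfolding u_def
    by (subst Bochner_Integration.integral_sum) (auto simp: integrable_pmf integral_pmf)
  finally show ?thesis by (simp only: c_def)
qed

section \<open>Random sums and the law of the given sum\<close>

definition iid_sum_pmf :: "nat pmf \<Rightarrow> nat \<Rightarrow> nat pmf" where
  "iid_sum_pmf Q z = map_pmf sum_list (replicate_pmf z Q)"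

lemma iid_sum_pmf_add: "iid_sum_pmf Q (a + b) = plus_pmf (iid_sum_pmf Q a) (iid_sum_pmf Q b)"
  by (simp add: iid_sum_pmf_def plus_pmf_eq_bind replicate_pmf_distrib map_bind_pmf bind_map_pmf)

text \<open>A sum of \<open>a + b\<close> i.i.d. terms splits into independent blocks, so the
  channel maps convolutions to convolutions; this permits induction on the number of
  summands.\<close>

lemma bind_plus_iid_sum_pmf:
  "bind_pmf (plus_pmf P R) (iid_sum_pmf Q) = plus_pmf (bind_pmf P (iid_sum_pmf Q)) (bind_pmf R (iid_sum_pmf Q))"
proof -
  have "bind_pmf (plus_pmf P R) (iid_sum_pmf Q)
      = bind_pmf P (\<lambda>a. bind_pmf R (\<lambda>b. bind_pmf (iid_sum_pmf Q a) (\<lambda>x. bind_pmf (iid_sum_pmf Q b) (\<lambda>y. return_pmf (x + y)))))"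
    by (simp only: plus_pmf_eq_bind[of P R] bind_assoc_pmf bind_return_pmf iid_sum_pmf_add)
      (simp only: plus_pmf_eq_bind)
  also have "\<dots> = bind_pmf P (\<lambda>a. bind_pmf (iid_sum_pmf Q a) (\<lambda>x. bind_pmf R (\<lambda>b. bind_pmf (iid_sum_pmf Q b) (\<lambda>y. return_pmf (x + y)))))"
    by (subst bind_commute_pmf) (rule refl)
  also have "\<dots> = plus_pmf (bind_pmf P (iid_sum_pmf Q)) (bind_pmf R (iid_sum_pmf Q))"
    by (simp only: plus_pmf_eq_bind bind_assoc_pmf)
  finally show ?thesis .
qed

text \<open>For \<open>b\<close> equal to 0 or 1, \<open>b * x\<close> is a sum of \<open>b\<close>
  draws from \<open>Q\<close>: empty or a single draw.\<close>

lemma map_mult_pair_bernoulli_pmf: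
  "map_pmf (\<lambda>(b, x). b * x) (pair_pmf (map_pmf of_bool (bernoulli_pmf p)) Q)
     = bind_pmf (map_pmf of_bool (bernoulli_pmf p)) (iid_sum_pmf Q)"
proof -
  have iid: "iid_sum_pmf Q (of_bool b) = map_pmf (\<lambda>x. of_bool b * x) Q" for b
    using replicate_pmf_1[of Q] by (cases b) (simp_all add: iid_sum_pmf_def map_pmf_comp)
  show ?thesis
    by (simp only: pair_pmf_def map_bind_pmf map_return_pmf bind_map_pmf iid prod.case map_pmf_def[symmetric])
      (simp add: map_pmf_def bind_assoc_pmf bind_return_pmf)
qed

text \<open>Transfers independence to mass functions; on a countable space comparing point masses
  suffices.\<close>

lemma (in prob_space) distr_indep_var_pmf:
  fixes U :: "'a \<Rightarrow> nat" and V :: "'a \<Rightarrow> nat"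
  assumes ind: "indep_var (count_space UNIV) U (count_space UNIV) V"
    and U: "distr M (count_space UNIV) U = measure_pmf P"
    and V: "distr M (count_space UNIV) V = measure_pmf R"
  shows "distr M (count_space UNIV) (\<lambda>\<omega>. f (U \<omega>) (V \<omega>)) = measure_pmf (map_pmf (\<lambda>(a, b). f a b) (pair_pmf P R))"
proof -
  have rv[measurable]: "U \<in> measurable M (count_space UNIV)" "V \<in> measurable M (count_space UNIV)"
    using ind by (auto dest: indep_var_rv1 indep_var_rv2)
  have UV[measurable]: "(\<lambda>\<omega>. (U \<omega>, V \<omega>)) \<in> measurable M (count_space UNIV)"
    by measurable
  have "distr M (count_space UNIV) (\<lambda>\<omega>. (U \<omega>, V \<omega>)) = measure_pmf (pair_pmf P R)"
  proof (rule measure_eqI_countable[of _ UNIV])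
    fix x :: "nat \<times> nat"
    obtain a b where x: "x = (a, b)" by (cases x)
    have "measure M (U -` {a} \<inter> space M) = pmf P a" "measure M (V -` {b} \<inter> space M) = pmf R b"
      using arg_cong[OF U, of "\<lambda>N. measure N {a}"] arg_cong[OF V, of "\<lambda>N. measure N {b}"]
      by (simp_all add: measure_distr measure_pmf_single)
    then have "measure M ((\<lambda>\<omega>. (U \<omega>, V \<omega>)) -` {x} \<inter> space M) = pmf (pair_pmf P R) x"
      using indep_varD[OF ind, of "{a}" "{b}"] by (simp add: x pmf_pair)
    then show "emeasure (distr M (count_space UNIV) (\<lambda>\<omega>. (U \<omega>, V \<omega>))) {x} = emeasure (measure_pmf (pair_pmf P R)) {x}"
      by (simp add: emeasure_distr emeasure_eq_measure emeasure_pmf_single)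
  qed auto
  then have "distr (distr M (count_space UNIV) (\<lambda>\<omega>. (U \<omega>, V \<omega>))) (count_space UNIV) (\<lambda>(a, b). f a b)
      = measure_pmf (map_pmf (\<lambda>(a, b). f a b) (pair_pmf P R))"
    by (simp add: map_pmf_rep_eq)
  then show ?thesis by (simp add: distr_distr comp_def)
qed

lemma (in prob_space) distr_sum_bernoulli_times:
  fixes X B :: "nat \<Rightarrow> 'a \<Rightarrow> nat"
  assumes ind: "indep_vars (\<lambda>_. count_space UNIV) (case_sum X B) ({1..n} <+> {1..n})"
    and X: "\<And>i. i \<in> {1..n} \<Longrightarrow> distr M (count_space UNIV) (X i) = measure_pmf Q"
    and B: "\<And>i. i \<in> {1..n} \<Longrightarrow>
           distr M (count_space UNIV) (B i) = measure_pmf (map_pmf of_bool (bernoulli_pmf (p i)))"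
    and "m \<le> n"
  shows "distr M (count_space UNIV) (\<lambda>\<omega>. \<Sum>i=1..m. B i \<omega> * X i \<omega>)
      = measure_pmf (bind_pmf (bernoulli_sum_pmf p m) (iid_sum_pmf Q))"
  using \<open>m \<le> n\<close>
proof (induction m)
  case 0
  have "distr M (count_space UNIV) (\<lambda>_. 0 :: nat) = return (count_space UNIV) 0"
    by (rule distr_const) auto
  then show ?case by (simp add: bind_return_pmf iid_sum_pmf_def return_pmf.rep_eq)
next
  case (Suc m)
  let ?C = "\<lambda>_ :: nat + nat. count_space UNIV :: nat measure"
  have comp: "(\<lambda>g. g (Inr i) * g (Inl i)) \<in> measurable (PiM J ?C) (count_space UNIV)"
    if "Inl i \<in> J" "Inr i \<in> J" for i :: nat and J :: "(nat + nat) set"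
    using that by measurable
  have sum_comp: "(\<lambda>g. \<Sum>i\<in>I. g (Inr i) * g (Inl i)) \<in> measurable (PiM (I <+> I) ?C) (count_space UNIV)"
    for I :: "nat set"
  proof -
    have "(\<lambda>g. \<Sum>i\<in>I. g (Inr i) * g (Inl i)) \<in> borel_measurable (PiM (I <+> I) ?C)"
      by (intro borel_measurable_sum) (simp add: measurable_cong_sets[OF refl sets_borel_eq_count_space] comp InlI InrI)
    then show ?thesis
      by (simp add: measurable_cong_sets[OF refl sets_borel_eq_count_space])
  qed
  have BX: "distr M (count_space UNIV) (\<lambda>\<omega>. B i \<omega> * X i \<omega>)
      = measure_pmf (bind_pmf (map_pmf of_bool (bernoulli_pmf (p i))) (iid_sum_pmf Q))"
    if i: "i \<in> {1..n}" for i
  proof -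
    have "indep_var (count_space UNIV) ((\<lambda>g. g (Inr i)) \<circ> (\<lambda>\<omega>. restrict (\<lambda>j. case_sum X B j \<omega>) {Inr i}))
      (count_space UNIV) ((\<lambda>g. g (Inl i)) \<circ> (\<lambda>\<omega>. restrict (\<lambda>j. case_sum X B j \<omega>) {Inl i}))"
      using i by (intro indep_var_compose[OF indep_var_restrict[OF ind]]) auto
    then have "indep_var (count_space UNIV) (B i) (count_space UNIV) (X i)"
      by (simp add: comp_def)
    from distr_indep_var_pmf[OF this B[OF i] X[OF i], of "(*)"] show ?thesis
      by (simp only: map_mult_pair_bernoulli_pmf)
  qed
  \<comment> \<open>The indices up to \<open>m\<close> and the index \<open>Suc m\<close> form
    disjoint blocks of the joint family, so the partial sum and the next product are
    independent.\<close>
  have "indep_var (count_space UNIV)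
      ((\<lambda>g. \<Sum>i\<in>{1..m}. g (Inr i) * g (Inl i)) \<circ> (\<lambda>\<omega>. restrict (\<lambda>j. case_sum X B j \<omega>) ({1..m} <+> {1..m})))
      (count_space UNIV)
      ((\<lambda>g. \<Sum>i\<in>{Suc m}. g (Inr i) * g (Inl i)) \<circ> (\<lambda>\<omega>. restrict (\<lambda>j. case_sum X B j \<omega>) ({Suc m} <+> {Suc m})))"
    using Suc.prems by (intro indep_var_compose[OF indep_var_restrict[OF ind]] sum_comp) auto
  then have "indep_var (count_space UNIV) (\<lambda>\<omega>. \<Sum>i=1..m. B i \<omega> * X i \<omega>)
      (count_space UNIV) (\<lambda>\<omega>. B (Suc m) \<omega> * X (Suc m) \<omega>)"
    by (simp add: comp_def InlI InrI)
  from distr_indep_var_pmf[OF this Suc.IH BX, of "(+)"] Suc.prems show ?case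
    by (simp add: plus_pmf_def[symmetric] bind_plus_iid_sum_pmf)
qed

theorem theorem1p1:
  fixes Q :: "nat pmf" and n :: nat and p :: "nat \<Rightarrow> real" and lam :: real
    and M :: "'a measure" and X B :: "nat \<Rightarrow> 'a \<Rightarrow> nat"
  assumes "0 \<notin> set_pmf Q"
    and "n \<ge> 1"
    and "\<And>i. i \<in> {1..n} \<Longrightarrow> p i \<in> {0<..<1}"
    and "prob_space M"
    and "prob_space.indep_vars M (\<lambda>_. count_space UNIV) (case_sum X B) ({1..n} <+> {1..n})"
    and "\<And>i. i \<in> {1..n} \<Longrightarrow> distr M (count_space UNIV) (X i) = measure_pmf Q"
    and "\<And>i. i \<in> {1..n} \<Longrightarrow>
           distr M (count_space UNIV) (B i) = measure_pmf (map_pmf of_bool (bernoulli_pmf (p i)))"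
    and "lam = (\<Sum>i=1..n. p i)"
  shows "rel_entropy (distr M (count_space UNIV) (\<lambda>\<omega>. \<Sum>i=1..n. B i \<omega> * X i \<omega>))
           (measure_pmf (compound_poisson lam Q))
         \<le> ereal (1 / lam * (\<Sum>i=1..n. p i ^ 3 / (1 - p i)))"
proof -
  interpret prob_space M by (rule assms(4))
  let ?W = "bernoulli_sum_pmf p n"
  have lam: "0 < lam" unfolding assms(8) using assms(2,3) by (intro sum_pos) auto
  have law: "distr M (count_space UNIV) (\<lambda>\<omega>. \<Sum>i=1..n. B i \<omega> * X i \<omega>)
      = measure_pmf (bind_pmf ?W (iid_sum_pmf Q))"
    by (rule distr_sum_bernoulli_times[OF assms(5,6,7) order_refl])
  have cpo: "compound_poisson lam Q = bind_pmf (poisson_pmf lam) (iid_sum_pmf Q)"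
    by (simp only: compound_poisson_def iid_sum_pmf_def[abs_def])
  \<comment> \<open>For \<open>lam > 0\<close> the Poisson law charges every natural number, hence
    dominates \<open>?W\<close>.\<close>
  have "rel_entropy (measure_pmf (bind_pmf ?W (iid_sum_pmf Q)))
      (measure_pmf (bind_pmf (poisson_pmf lam) (iid_sum_pmf Q)))
      \<le> ereal (\<Sum>w\<in>set_pmf ?W. pmf ?W w * ln (pmf ?W w / pmf (poisson_pmf lam) w))"
    using lam by (intro rel_entropy_bind_pmf_le)
      (auto intro: finite_subset[OF set_bernoulli_sum_pmf])
  also have "ereal (\<Sum>w\<in>set_pmf ?W. pmf ?W w * ln (pmf ?W w / pmf (poisson_pmf lam) w))
      \<le> ereal (1 / lam * (\<Sum>i=1..n. p i ^ 3 / (1 - p i)))"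
    unfolding assms(8) ereal_less_eq by (rule bernoulli_sum_poisson_entropy_le[OF assms(2,3)])
  finally show ?thesis unfolding law cpo .
qed

end
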